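(* For every constant $\epsilon>0$, every comparison-based $n^{1-\epsilon}$-approximation algorithm for the one-dimensional Traveling Salesman (path) Problem requires $\Omega(\epsilon\, n\log n)$ comparisons in the worst case on inputs of size $n$. That is, there is an absolute constant $c>0$ such that for every constant $\epsilon>0$ and all sufficiently large $n$, any such algorithm uses at least $c\,\epsilon\, n\log n$ comparisons on some input of $n$ points.
   Context: One-dimensional TSP (path version): the input is $n$ real numbers $x_1,\dots,x_n$; a solution is an ordering of them, i.e. a permutation $\sigma$ of $\{1,\dots,n\}$, with cost $\sum_{i=1}^{n-1}|x_{\sigma(i+1)}-x_{\sigma(i)}|$. An $r$-approximation algorithm always outputs a solution whose cost is at most $r$ times the minimum possible cost. A comparison-based algorithm is one that accesses the input only through binary (True/False) queries; the number of comparisons is the number of such queries made. *)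

theory Defs
  imports Complex_Main "HOL-Combinatorics.Permutations"
begin

text \<open>
  An instance of size \<open>n\<close> is a list of \<open>n\<close> reals (repetitions allowed); a solution is a
  permutation of the positions \<open>0, \<dots>, n - 1\<close>.
\<close>

definition path_cost :: "real list \<Rightarrow> (nat \<Rightarrow> nat) \<Rightarrow> real" where
  "path_cost xs \<sigma> = (\<Sum>i<length xs - 1. \<bar>xs ! \<sigma> (i + 1) - xs ! \<sigma> i\<bar>)"

definition opt_cost :: "real list \<Rightarrow> real" where
  "opt_cost xs = Min (path_cost xs ` {\<sigma>. \<sigma> permutes {..<length xs}})"

text \<open>
  A deterministic algorithm that sees its input (of type \<open>'i\<close>) only through adaptive yes/no
  queries is a binary decision tree.  The queries are arbitrary predicates of the whole input, not
  only order comparisons of two entries.  The type is coinductive, so the tree may have infinite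
  branches; termination is a separate matter, expressed by \<open>runs\<close>.
\<close>

codatatype ('i, 'o) decision_tree =
    Output 'o
  | Query "'i \<Rightarrow> bool" "('i, 'o) decision_tree" "('i, 'o) decision_tree"

text \<open>
  \<open>runs t x k z\<close>: on input \<open>x\<close> the algorithm \<open>t\<close> halts after exactly \<open>k\<close> queries with output \<open>z\<close>.
\<close>

inductive runs :: "('i, 'o) decision_tree \<Rightarrow> 'i \<Rightarrow> nat \<Rightarrow> 'o \<Rightarrow> bool" where
  Output: "runs (Output z) x 0 z"
| Query: "runs (if q x then t else u) x k z \<Longrightarrow> runs (Query q t u) x (Suc k) z"

lemma runs_deterministic:
  assumes "runs t x k z" and "runs t x k' z'"
  shows "k = k' \<and> z = z'"
  using assms
proof (induction arbitrary: k' z' rule: runs.induct)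
  case (Output z x)
  then show ?case by (auto elim: runs.cases)
next
  case (Query q x t u k z)
  from Query.prems obtain j where "k' = Suc j" "runs (if q x then t else u) x j z'"
    by (auto elim: runs.cases)
  with Query.IH show ?case by blast
qed

text \<open>One tree per instance size; the approximation ratio \<open>r\<close> may depend on the size.\<close>

type_synonym tsp_algorithm = "nat \<Rightarrow> (real list, nat \<Rightarrow> nat) decision_tree"

definition tsp_approximation :: "(nat \<Rightarrow> real) \<Rightarrow> tsp_algorithm \<Rightarrow> bool" where
  "tsp_approximation r A \<longleftrightarrow>
    (\<forall>xs. \<exists>k \<sigma>. runs (A (length xs)) xs k \<sigma> \<and> \<sigma> permutes {..<length xs} \<and>
       path_cost xs \<sigma> \<le> r (length xs) * opt_cost xs)"

end

theory Submission
  imports Defs "HOL-Real_Asymp.Real_Asymp"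
begin

text \<open>
  Use the \<open>n!\<close> instances whose points are \<open>0, \<dots>, n - 1\<close> in some order; each has optimum at most
  \<open>n - 1\<close>.  A fixed output is an \<open>r\<close>-approximation for few of them: the tour visits the points in an
  order \<open>\<rho>\<close> with \<open>\<Sum> \<bar>\<rho> (i + 1) - \<rho> i\<bar> \<le> r (n - 1)\<close>, and since \<open>\<rho>\<close> is determined by its first value and
  its nonzero increments, an exponential-moment (Chernoff) bound leaves at most
  \<open>n (2 e r)\<^bsup>n - 1\<^esup>\<close> choices.  With \<open>k\<close> queries there are at most \<open>2\<^bsup>k\<^esup>\<close> outputs, so
  \<open>n! \<le> 2\<^bsup>k\<^esup> n (2 e r)\<^bsup>n - 1\<^esup>\<close>.  For \<open>r = n\<^bsup>1 - \<epsilon>\<^esup>\<close> this gives \<open>k \<ge> \<epsilon> n ln n - O(n)\<close>.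
\<close>

section \<open>Outputs of shallow decision trees\<close>

lemma runs_Output_iff: "runs (Output z) x k z' \<longleftrightarrow> k = 0 \<and> z' = z"
  by (auto elim: runs.cases intro: runs.intros)

lemma runs_Query_iff:
  "runs (Query q t u) x k z \<longleftrightarrow> (\<exists>j. k = Suc j \<and> runs (if q x then t else u) x j z)"
  by (auto elim: runs.cases intro: runs.Query)

text \<open>The induction is on \<open>K\<close>, since a coinductive tree may have infinite
  branches. After one query the run continues in one of two subtrees, so each further query at most
  doubles the number of outputs.\<close>

lemma card_outputs_le:
  "finite {z. \<exists>x k. k \<le> K \<and> runs t x k z} \<and> card {z. \<exists>x k. k \<le> K \<and> runs t x k z} \<le> 2 ^ K"
proof (induction K arbitrary: t)
  case 0
  show ?case
  proof (cases t)
    case (Output z)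
    then have "{z. \<exists>x k. k \<le> 0 \<and> runs t x k z} \<subseteq> {z}" by (auto simp: runs_Output_iff)
    then show ?thesis using card_mono[of "{z}"] finite_subset by fastforce
  next
    case (Query q u v)
    then have "{z. \<exists>x k. k \<le> 0 \<and> runs t x k z} = {}" by (auto simp: runs_Query_iff)
    then show ?thesis by simp
  qed
next
  case (Suc K)
  let ?Z = "\<lambda>K t. {z. \<exists>x k. k \<le> K \<and> runs t x k z}"
  show ?case
  proof (cases t)
    case (Output z)
    then have "?Z (Suc K) t \<subseteq> {z}" by (auto simp: runs_Output_iff)
    then have "finite (?Z (Suc K) t)" "card (?Z (Suc K) t) \<le> 1"
      using card_mono[of "{z}"] finite_subset by fastforce+
    then show ?thesis using order_trans[OF _ one_le_power[of "2::nat" "Suc K"]] by auto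
  next
    case (Query q u v)
    have sub: "?Z (Suc K) t \<subseteq> ?Z K u \<union> ?Z K v"
    proof
      fix z assume "z \<in> ?Z (Suc K) t"
      then obtain x j where "j \<le> K" "runs (if q x then u else v) x j z"
        by (auto simp: Query runs_Query_iff)
      then show "z \<in> ?Z K u \<union> ?Z K v" by (cases "q x") auto
    qed
    have fin: "finite (?Z K u \<union> ?Z K v)" using Suc by auto
    have "card (?Z (Suc K) t) \<le> card (?Z K u \<union> ?Z K v)" by (rule card_mono[OF fin sub])
    also have "\<dots> \<le> card (?Z K u) + card (?Z K v)" by (rule card_Un_le)
    also have "\<dots> \<le> 2 ^ K + 2 ^ K" using Suc add_mono by blast
    finally show ?thesis using finite_subset[OF sub fin] by simp
  qed
qed

section \<open>Chernoff bound for permutations of small total variation\<close>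

text \<open>A geometric sum with ratio \<open>q = exp (- s)\<close> is at most
  \<open>q / (1 - q)\<close>, which equals \<open>1 / (exp s - 1)\<close>; then
  \<open>1 + s \<le> exp s\<close>.\<close>

lemma sum_exp_neg_le:
  fixes s :: real
  assumes "s > 0"
  shows "(\<Sum>d = 1..n. exp (- s * real d)) \<le> 1 / s"
proof -
  define q where "q = exp (- s)"
  have q: "0 < q" "q < 1" using assms by (auto simp: q_def)
  have "(\<Sum>d = 1..n. q ^ d) * (1 - q) = q - q ^ Suc n"
  proof (induction n)
    case (Suc n)
    have "(\<Sum>d = 1..Suc n. q ^ d) * (1 - q) = (\<Sum>d = 1..n. q ^ d) * (1 - q) + q ^ Suc n * (1 - q)"
      by (simp add: distrib_right)
    also have "\<dots> = q - q ^ Suc (Suc n)" unfolding Suc.IH by (simp add: algebra_simps)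
    finally show ?case .
  qed simp
  also have "\<dots> \<le> q" using q by simp
  finally have "(\<Sum>d = 1..n. q ^ d) \<le> q / (1 - q)" using q by (simp add: field_simps)
  also have "q / (1 - q) \<le> 1 / s"
  proof -
    have "q * (1 + s) \<le> q * exp s" using q by (intro mult_left_mono exp_ge_add_one_self) auto
    also have "\<dots> = 1" by (simp add: q_def flip: exp_add)
    finally show ?thesis using q assms by (simp add: field_simps)
  qed
  also have "(\<Sum>d = 1..n. q ^ d) = (\<Sum>d = 1..n. exp (- s * real d))"
    unfolding q_def exp_of_nat_mult[symmetric] by (simp add: mult.commute)
  finally show ?thesis .
qed

text \<open>Leaving out 0 avoids an additive 1. The bound stays proportional to \<open>1 / s\<close>
  for large \<open>s\<close> too, which covers ratios below 1, so \<epsilon> > 1 needs no separate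
  case.\<close>

lemma sum_exp_neg_abs_le:
  fixes s :: real
  assumes "s > 0"
  shows "(\<Sum>d \<in> {- int n..int n} - {0}. exp (- s * \<bar>real_of_int d\<bar>)) \<le> 2 / s"
proof -
  let ?f = "\<lambda>d. exp (- s * \<bar>real_of_int d\<bar>)"
  have "{- int n..int n} - {0} = int ` {1..n} \<union> (\<lambda>d. - int d) ` {1..n}"
  proof (intro equalityI subsetI)
    fix d assume d: "d \<in> {- int n..int n} - {0}"
    show "d \<in> int ` {1..n} \<union> (\<lambda>d. - int d) ` {1..n}"
    proof (cases "d > 0")
      case True
      then have "d = int (nat d)" "nat d \<in> {1..n}" using d by auto
      then show ?thesis by blast
    next
      case False
      then have "d = - int (nat (- d))" "nat (- d) \<in> {1..n}" using d by auto
      then show ?thesis by blast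
    qed
  qed auto
  then have "sum ?f ({- int n..int n} - {0}) =
      sum ?f (int ` {1..n}) + sum ?f ((\<lambda>d. - int d) ` {1..n})"
    by (simp only:) (intro sum.union_disjoint; auto)
  also have "\<dots> = 2 * (\<Sum>d = 1..n. exp (- s * real d))"
    by (simp add: sum.reindex inj_on_def)
  also have "\<dots> \<le> 2 * (1 / s)" by (intro mult_left_mono sum_exp_neg_le assms) auto
  finally show ?thesis by simp
qed

lemma card_permutations_small_variation:
  fixes r :: real
  assumes n: "n > 0" and r: "r > 0"
  shows "real (card {\<rho>. \<rho> permutes {..<n} \<and>
      (\<Sum>i<n - 1. \<bar>real (\<rho> (i + 1)) - real (\<rho> i)\<bar>) \<le> r * real (n - 1)})
    \<le> real n * (2 * exp 1 * r) ^ (n - 1)"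
proof -
  define m where "m = n - 1"
  define P where "P = {\<rho>. \<rho> permutes {..<n} \<and>
      (\<Sum>i<m. \<bar>real (\<rho> (i + 1)) - real (\<rho> i)\<bar>) \<le> r * real m}"
  define S where "S = {- int n..int n} - {0}"
  define D where "D = PiE {..<m} (\<lambda>_. S)"
  define T where "T = {d \<in> D. (\<Sum>i<m. \<bar>real_of_int (d i)\<bar>) \<le> r * real m}"
  \<comment> \<open>The exponential weight with parameter \<open>s = 1 / r\<close>, which minimises
    the resulting bound \<open>exp (s * r * m) * (2 / s) ^ m\<close>.\<close>
  define w where "w = (\<lambda>d :: nat \<Rightarrow> int. \<Prod>i<m. exp (- (1 / r) * \<bar>real_of_int (d i)\<bar>))"
  \<comment> \<open>First value plus increments. The restriction to \<open>{..<m}\<close> makes the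
    increment sequence an element of the extensional function space \<open>D\<close>.\<close>
  define g where "g = (\<lambda>\<rho> :: nat \<Rightarrow> nat. (\<rho> 0, \<lambda>i\<in>{..<m}. int (\<rho> (i + 1)) - int (\<rho> i)))"
  have finD: "finite D" unfolding D_def S_def by (intro finite_PiE) auto
  then have finT: "finite T" by (simp add: T_def)
  have "inj_on g P"
  proof (rule inj_onI)
    fix \<rho> \<tau> assume \<rho>: "\<rho> \<in> P" and \<tau>: "\<tau> \<in> P" and eq: "g \<rho> = g \<tau>"
    have step: "int (\<rho> (i + 1)) - int (\<rho> i) = int (\<tau> (i + 1)) - int (\<tau> i)" if "i < m" for i
    proof -
      have "snd (g \<rho>) i = snd (g \<tau>) i" using eq by simp
      then show ?thesis using that by (simp add: g_def)
    qed
    have le: "\<rho> i = \<tau> i" if "i \<le> m" for i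
      using that
    proof (induction i)
      case 0
      then show ?case using eq by (simp add: g_def)
    next
      case (Suc i)
      then show ?case using step[of i] by simp
    qed
    show "\<rho> = \<tau>"
    proof
      fix i
      show "\<rho> i = \<tau> i"
      proof (cases "i < n")
        case True
        then show ?thesis using le[of i] by (simp add: m_def)
      next
        case False
        \<comment> \<open>Outside \<open>{..<n}\<close> both permutations are the identity, so
          agreement on \<open>0, ..., m = n - 1\<close> suffices.\<close>
        then have "\<rho> i = i" "\<tau> i = i" using \<rho> \<tau> by (auto simp: P_def permutes_def)
        then show ?thesis by simp
      qed
    qed
  qed
  moreover have "g ` P \<subseteq> {..<n} \<times> T"
  proof
    fix y assume "y \<in> g ` P"
    then obtain \<rho> where y: "y = g \<rho>" and \<rho>: "\<rho> permutes {..<n}"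
      and var: "(\<Sum>i<m. \<bar>real (\<rho> (i + 1)) - real (\<rho> i)\<bar>) \<le> r * real m"
      by (auto simp: P_def)
    have lt: "\<rho> i < n" if "i < n" for i
      using permutes_in_image[OF \<rho>, of i] that by simp
    have "int (\<rho> (i + 1)) - int (\<rho> i) \<in> S" if "i < m" for i
    proof -
      have "\<rho> (i + 1) \<noteq> \<rho> i" using inj_eq[OF permutes_inj[OF \<rho>]] by simp
      moreover have "\<rho> i < n" "\<rho> (i + 1) < n" using lt that by (auto simp: m_def)
      ultimately show ?thesis by (simp add: S_def)
    qed
    then have "snd (g \<rho>) \<in> D" by (auto simp: g_def D_def)
    then have "snd (g \<rho>) \<in> T" using var by (simp add: T_def g_def)
    moreover have "fst (g \<rho>) < n" using lt[of 0] n by (simp add: g_def)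
    ultimately show "y \<in> {..<n} \<times> T" unfolding y by (cases "g \<rho>") auto
  qed
  ultimately have "card P \<le> card ({..<n} \<times> T)"
    using finT by (intro card_inj_on_le) auto
  then have "real (card P) \<le> real (n * card T)"
    by (simp only: of_nat_le_iff card_cartesian_product card_lessThan)
  moreover have "real (card T) \<le> (2 * exp 1 * r) ^ m"
  proof -
    \<comment> \<open>Markov-style step: membership in \<open>T\<close> makes the exponent
      \<open>m - (\<Sum>i<m. \<bar>d i\<bar>) / r\<close> nonnegative.\<close>
    have "1 \<le> exp (real m) * w d" if "d \<in> T" for d
    proof -
      have "(\<Sum>i<m. \<bar>real_of_int (d i)\<bar>) / r \<le> real m"
        using that r by (simp add: T_def field_simps)
      then have "1 \<le> exp (real m + (\<Sum>i<m. - (1 / r) * \<bar>real_of_int (d i)\<bar>))"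
        by (simp add: sum_negf sum_divide_distrib)
      then show ?thesis by (simp only: w_def exp_add exp_sum[OF finite_lessThan])
    qed
    then have "real (card T) \<le> (\<Sum>d\<in>T. exp (real m) * w d)"
      using sum_mono[of T "\<lambda>_. 1::real" "\<lambda>d. exp (real m) * w d"] by simp
    also have "\<dots> \<le> (\<Sum>d\<in>D. exp (real m) * w d)"
      using finD by (intro sum_mono2) (auto simp: T_def w_def intro!: prod_nonneg mult_nonneg_nonneg)
    also have "\<dots> = exp (real m) * (\<Sum>d\<in>D. w d)" by (simp add: sum_distrib_left)
    \<comment> \<open>With the variation constraint dropped the increments are independent, and the
      sum over \<open>D\<close> factors into \<open>m\<close> equal sums, each at most
      \<open>2 * r\<close>.\<close>
    also have "(\<Sum>d\<in>D. w d) = (\<Prod>i<m. \<Sum>d\<in>S. exp (- (1 / r) * \<bar>real_of_int d\<bar>))"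
      unfolding w_def D_def by (subst prod_sum_PiE) (auto simp: S_def)
    also have "\<dots> \<le> (\<Prod>i<m. 2 / (1 / r))"
      using sum_exp_neg_abs_le[of "1 / r" n] r
      by (intro prod_mono conjI sum_nonneg) (auto simp: S_def)
    also have "exp (real m) * \<dots> = (2 * exp 1 * r) ^ m"
      by (simp add: power_mult_distrib mult_ac flip: exp_of_nat_mult)
    finally show ?thesis by simp
  qed
  ultimately have "real (card P) \<le> real n * (2 * exp 1 * r) ^ m"
    using mult_left_mono[of "real (card T)" "(2 * exp 1 * r) ^ m" "real n"] by simp
  then show ?thesis by (simp add: P_def m_def)
qed

section \<open>Counting permutation instances\<close>

text \<open>The tour \<open>inv \<pi>\<close> visits the points in increasing order, by unit
  steps.\<close>

lemma opt_cost_permutation_le: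
  assumes \<pi>: "\<pi> permutes {..<n}"
  shows "opt_cost (map (\<lambda>i. real (\<pi> i)) [0..<n]) \<le> real (n - 1)"
proof -
  let ?xs = "map (\<lambda>i. real (\<pi> i)) [0..<n]"
  have inv: "inv \<pi> permutes {..<n}" by (rule permutes_inv[OF \<pi>])
  have "?xs ! inv \<pi> i = real i" if "i < n" for i
    using permutes_in_image[OF inv, of i] permutes_inverses(1)[OF \<pi>, of i] that by simp
  then have "path_cost ?xs (inv \<pi>) = (\<Sum>i<n - 1. 1)"
    unfolding path_cost_def by (intro sum.cong) auto
  moreover have "opt_cost ?xs \<le> path_cost ?xs (inv \<pi>)"
    unfolding opt_cost_def using inv by (intro Min_le) (auto simp: finite_permutations)
  ultimately show ?thesis by simp
qed

text \<open>If \<sigma> is the output on instance \<pi>, then \<open>\<pi> \<circ> \<sigma>\<close>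
  lists the points in tour order and has small variation. Since \<pi> is recovered from \<sigma> and
  \<open>\<pi> \<circ> \<sigma>\<close>, the \<open>n!\<close> instances inject into pairs of a
  reachable output and a permutation of small variation.\<close>

lemma tsp_approximation_fact_le:
  assumes A: "tsp_approximation r A" and n: "n > 0" and r: "r n > 0"
    and bound: "\<And>xs k \<sigma>. length xs = n \<Longrightarrow> runs (A n) xs k \<sigma> \<Longrightarrow> k \<le> K"
  shows "fact n \<le> 2 ^ K * (real n * (2 * exp 1 * r n) ^ (n - 1))"
proof -
  define inst where "inst = (\<lambda>\<pi> :: nat \<Rightarrow> nat. map (\<lambda>i. real (\<pi> i)) [0..<n])"
  define B where "B = {\<rho>. \<rho> permutes {..<n} \<and>
      (\<Sum>i<n - 1. \<bar>real (\<rho> (i + 1)) - real (\<rho> i)\<bar>) \<le> r n * real (n - 1)}"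
  define Z where "Z = {\<sigma>. \<exists>x k. k \<le> K \<and> runs (A n) x k \<sigma>}"
  have finB: "finite B"
    by (rule finite_subset[OF _ finite_permutations[of "{..<n}"]]) (auto simp: B_def)
  have Z: "finite Z" "card Z \<le> 2 ^ K" using card_outputs_le[of K "A n"] by (auto simp: Z_def)
  have "{\<pi>. \<pi> permutes {..<n}} \<subseteq> (\<lambda>(\<sigma>, \<rho>). \<rho> \<circ> inv \<sigma>) ` (Z \<times> B)"
  proof
    fix \<pi> assume "\<pi> \<in> {\<pi>. \<pi> permutes {..<n}}"
    then have \<pi>: "\<pi> permutes {..<n}" by simp
    have len: "length (inst \<pi>) = n" by (simp add: inst_def)
    obtain k \<sigma> where run: "runs (A n) (inst \<pi>) k \<sigma>" and \<sigma>: "\<sigma> permutes {..<n}"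
      and cost: "path_cost (inst \<pi>) \<sigma> \<le> r n * opt_cost (inst \<pi>)"
      using A len unfolding tsp_approximation_def by metis
    have "\<sigma> \<in> Z" using run bound[OF len run] by (auto simp: Z_def)
    have lt: "\<sigma> i < n" if "i < n" for i
      using permutes_in_image[OF \<sigma>, of i] that by simp
    have "(\<Sum>i<n - 1. \<bar>real (\<pi> (\<sigma> (i + 1))) - real (\<pi> (\<sigma> i))\<bar>) = path_cost (inst \<pi>) \<sigma>"
      unfolding path_cost_def len using lt by (intro sum.cong) (auto simp: inst_def)
    also have "\<dots> \<le> r n * real (n - 1)"
      using cost mult_left_mono[OF opt_cost_permutation_le[OF \<pi>], of "r n"] r
      unfolding inst_def by linarith
    finally have "\<pi> \<circ> \<sigma> \<in> B" using permutes_compose[OF \<sigma> \<pi>] by (simp add: B_def)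
    moreover have "\<pi> = (\<pi> \<circ> \<sigma>) \<circ> inv \<sigma>"
      using permutes_inv_o(1)[OF \<sigma>] by (simp add: comp_assoc)
    ultimately show "\<pi> \<in> (\<lambda>(\<sigma>, \<rho>). \<rho> \<circ> inv \<sigma>) ` (Z \<times> B)"
      using \<open>\<sigma> \<in> Z\<close> by (intro image_eqI[of _ _ "(\<sigma>, \<pi> \<circ> \<sigma>)"]) auto
  qed
  then have "card {\<pi>. \<pi> permutes {..<n}} \<le> card (Z \<times> B)"
    using Z finB by (intro surj_card_le) auto
  then have "fact n \<le> card Z * card B"
    by (simp add: card_permutations[of _ n] card_cartesian_product)
  then have "real (fact n) \<le> real (card Z) * real (card B)"
    by (metis of_nat_le_iff of_nat_mult)
  also have "\<dots> \<le> 2 ^ K * (real n * (2 * exp 1 * r n) ^ (n - 1))"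
  proof (rule mult_mono)
    show "real (card Z) \<le> 2 ^ K" using Z(2) by (metis of_nat_le_iff of_nat_numeral of_nat_power)
    show "real (card B) \<le> real n * (2 * exp 1 * r n) ^ (n - 1)"
      unfolding B_def by (rule card_permutations_small_variation[OF n r])
  qed auto
  finally show ?thesis by simp
qed

section \<open>Asymptotics of the counting inequality\<close>

text \<open>A weak Stirling bound: the term of index \<open>n\<close> in the series of
  \<open>exp n\<close> is at most the whole series.\<close>

lemma power_self_le_fact_mult_exp: "real n ^ n \<le> fact n * exp (real n)"
proof -
  have "(\<Sum>k\<in>{n}. real n ^ k /\<^sub>R fact k) \<le> exp (real n)"
    unfolding exp_def by (intro sum_le_suminf summable_exp_generic) auto
  then show ?thesis by (simp add: field_simps)
qed

theorem theorem1:
  "\<exists>c::real. c > 0 \<and>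
    (\<forall>\<epsilon>::real. \<epsilon> > 0 \<longrightarrow>
      (\<forall>\<^sub>F n in sequentially. \<forall>A.
        tsp_approximation (\<lambda>m. real m powr (1 - \<epsilon>)) A \<longrightarrow>
          (\<exists>xs k \<sigma>. length xs = n \<and> runs (A n) xs k \<sigma> \<and>
             real k \<ge> c * \<epsilon> * real n * ln (real n))))"
\<comment> \<open>Any constant below 1 would serve here: the count forces about
  \<open>\<epsilon> * n * ln n\<close> queries, up to a linear error.\<close>
proof (intro exI[of _ "1/2"] conjI allI impI)
  fix \<epsilon> :: real assume \<epsilon>: "\<epsilon> > 0"
  \<comment> \<open>This contradicts the inequality derived at the end. There \<open>3 * n\<close>
    absorbs \<open>2 * (n - 1)\<close> from the constant factors of the Chernoff bound and
    \<open>n\<close> from the bound on the factorial.\<close>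
  have "\<forall>\<^sub>F n in sequentially.
      \<epsilon> * (real n - 1) * ln (real n) - 1 / 2 * \<epsilon> * real n * ln (real n) - 3 * real n > 0"
    using \<epsilon> by real_asymp
  then show "\<forall>\<^sub>F n in sequentially. \<forall>A.
        tsp_approximation (\<lambda>m. real m powr (1 - \<epsilon>)) A \<longrightarrow>
          (\<exists>xs k \<sigma>. length xs = n \<and> runs (A n) xs k \<sigma> \<and>
             real k \<ge> 1 / 2 * \<epsilon> * real n * ln (real n))"
    using eventually_gt_at_top[of 0]
  proof eventually_elim
    case (elim n)
    define L where "L = ln (real n)"
    show ?case
    proof (intro allI impI, rule ccontr)
      fix A
      assume A: "tsp_approximation (\<lambda>m. real m powr (1 - \<epsilon>)) A"
        and no: "\<not> (\<exists>xs k \<sigma>. length xs = n \<and> runs (A n) xs k \<sigma> \<and>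
             real k \<ge> 1 / 2 * \<epsilon> * real n * ln (real n))"
      define K where "K = nat \<lfloor>1 / 2 * \<epsilon> * real n * L\<rfloor>"
      have n: "real n = exp L" and "L \<ge> 0" using elim by (auto simp: L_def)
      have K: "real K \<le> 1 / 2 * \<epsilon> * real n * L"
        unfolding K_def using \<epsilon> \<open>L \<ge> 0\<close> by (intro of_nat_floor) simp
      have "k \<le> K" if "length xs = n" "runs (A n) xs k \<sigma>" for xs k \<sigma>
      proof -
        have "real k \<le> 1 / 2 * \<epsilon> * real n * L" using no that by (force simp: L_def)
        then show ?thesis unfolding K_def by (simp add: le_nat_floor)
      qed
      then have "fact n \<le> 2 ^ K * (real n * (2 * exp 1 * real n powr (1 - \<epsilon>)) ^ (n - 1))"
        using elim by (intro tsp_approximation_fact_le[OF A]) auto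
      \<comment> \<open>Both occurrences of 2 are raised to \<open>exp 1\<close>, so that the
        right-hand side becomes a single exponential; the constant 1/2 leaves room for this
        loss.\<close>
      also have "\<dots> \<le> exp 1 ^ K * (real n * (exp 1 * exp 1 * exp ((1 - \<epsilon>) * L)) ^ (n - 1))"
      proof -
        have "(2::real) \<le> exp 1" using exp_ge_add_one_self[of 1] by simp
        moreover have "real n powr (1 - \<epsilon>) = exp ((1 - \<epsilon>) * L)"
          using elim by (simp add: powr_def L_def)
        ultimately show ?thesis
          by (intro mult_mono power_mono mult_left_mono) auto
      qed
      also have "\<dots> = exp (real K + (L + real (n - 1) * (2 + (1 - \<epsilon>) * L)))"
        by (simp only: n exp_add[symmetric] exp_of_nat_mult[symmetric]) (simp add: algebra_simps)
      finally have fact_le: "fact n \<le> exp (real K + (L + real (n - 1) * (2 + (1 - \<epsilon>) * L)))" .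
      have "exp (real n * L) = real n ^ n" unfolding exp_of_nat_mult by (simp only: n)
      also have "\<dots> \<le> fact n * exp (real n)" by (rule power_self_le_fact_mult_exp)
      also have "\<dots> \<le> exp (real K + (L + real (n - 1) * (2 + (1 - \<epsilon>) * L))) * exp (real n)"
        by (intro mult_right_mono fact_le) auto
      finally have "real n * L \<le> real K + (L + real (n - 1) * (2 + (1 - \<epsilon>) * L)) + real n"
        by (simp flip: exp_add)
      then have "real n * L \<le>
          1 / 2 * \<epsilon> * real n * L + (L + (real n - 1) * (2 + (1 - \<epsilon>) * L)) + real n"
        using K elim by (simp add: of_nat_diff)
      moreover have "\<epsilon> * (real n - 1) * L - 1 / 2 * \<epsilon> * real n * L - 3 * real n > 0"
        using elim by (simp add: L_def)
      ultimately show False by (simp add: algebra_simps)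
    qed
  qed
qed simp

end
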